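(* Let $E_1\ne E_2$ be two distinct extreme rays of $\Gamma_4$, each containing a rank-$1$ matroid, i.e. each is of one of the types $U^i_{1,1}$ ($i\in N_4$), $U^\alpha_{1,2}$ ($\alpha\subseteq N_4$, $|\alpha|=2$), $U^\alpha_{1,3}$ ($\alpha\subseteq N_4$, $|\alpha|=3$), $U_{1,4}$. Let $F=(E_1,E_2)$ be the face of $\Gamma_4$ spanned by them, i.e. $F=\{a\mathbf r_1+b\mathbf r_2: a,b\ge 0\}$ where $\mathbf r_1,\mathbf r_2$ are the rank functions of the corresponding matroids. Then every $\mathbf h\in F$ is entropic.
   Context: $N_4=\{1,2,3,4\}$. $\Gamma_4$ is the cone of all polymatroid rank functions on $N_4$ (nonnegative, monotone, submodular set functions $\mathbf h:2^{N_4}\to\mathbb R$ with $\mathbf h(\emptyset)=0$). A set function $\mathbf h:2^{N_4}\to\mathbb R$ is called entropic if there is a random vector $(X_1,X_2,X_3,X_4)$, each $X_i$ taking values in a finite set, with $\mathbf h(A)=H(X_A)$ for all $A\subseteq N_4$, where $H$ is Shannon entropy, $X_A=(X_j,j\in A)$ and $\mathbf h(\emptyset)=0$. For $\alpha\subseteq N_4$ with $|\alpha|=m$, $U^\alpha_{k,m}$ is the matroid on $N_4$ with rank function $\mathbf r(A)=\min\{k,|A\cap\alpha|\}$ (uniform on $\alpha$, other elements loops); $U^i_{1,1}$ means $\alpha=\{i\}$, and $U_{1,4}$ means $\alpha=N_4$. The symbol of a matroid also denotes the ray $\{a\mathbf r:a\ge0\}$ generated by its rank function. *)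

theory Defs
  imports "HOL-Probability.Probability"
begin

text \<open>
  The ground set is the four-element type \<open>4\<close> (whose elements are the residues
  \<open>1, 2, 3, 4 = 0\<close>), so the full set is \<open>UNIV :: 4 set\<close>.  A set function on its subsets is a
  vector with one coordinate per subset, which puts the polymatroid cone in a Euclidean space, where
  the library notions of face and hull apply.
\<close>

type_synonym set_fun = "real ^ (4 set)"

definition Gamma4 :: "set_fun set" where
  "Gamma4 = {h. h $ {} = 0 \<and> (\<forall>A. 0 \<le> h $ A) \<and> (\<forall>A B. A \<subseteq> B \<longrightarrow> h $ A \<le> h $ B)
     \<and> (\<forall>A B. h $ (A \<union> B) + h $ (A \<inter> B) \<le> h $ A + h $ B)}"

definition matroid_rank :: "set_fun \<Rightarrow> bool" where
  "matroid_rank r \<longleftrightarrow> r \<in> Gamma4 \<and> (\<forall>A. r $ A \<in> \<int> \<and> r $ A \<le> real (card A))"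

definition rank_one_matroid :: "set_fun \<Rightarrow> bool" where
  "rank_one_matroid r \<longleftrightarrow> matroid_rank r \<and> r $ UNIV = 1"

definition uniform_rank :: "nat \<Rightarrow> 4 set \<Rightarrow> set_fun" where
  "uniform_rank k \<alpha> = (\<chi> A. real (min k (card (A \<inter> \<alpha>))))"

definition ray :: "set_fun \<Rightarrow> set_fun set" where
  "ray r = {a *\<^sub>R r | a. 0 \<le> a}"

definition extreme_ray_of :: "set_fun set \<Rightarrow> set_fun set \<Rightarrow> bool" where
  "extreme_ray_of E K \<longleftrightarrow> (\<exists>r. r \<noteq> 0 \<and> E = ray r) \<and> E face_of K"

text \<open>The smallest face of \<open>K\<close> that contains \<open>S\<close>.\<close>

definition spanned_face :: "set_fun set \<Rightarrow> set_fun set \<Rightarrow> set_fun set" where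
  "spanned_face K S = (\<lambda>T. T face_of K) hull S"

text \<open>
  Entropicity with entropy measured to the logarithmic base \<open>b\<close>.  Each \<open>X i\<close> takes finitely many
  values because \<open>simple_function\<close> demands a finite range; \<open>\<lambda>i\<in>A. X i \<omega>\<close> is the subvector
  indexed by \<open>A\<close>.  Only the finitely supported joint law of the \<open>X i\<close> matters, so taking
  \<open>nat\<close> for the sample space and for the values loses nothing.
\<close>

definition entropic :: "real \<Rightarrow> set_fun \<Rightarrow> bool" where
  "entropic b h \<longleftrightarrow> (\<exists>(M :: nat measure) (X :: 4 \<Rightarrow> nat \<Rightarrow> nat).
     prob_space M \<and> (\<forall>i. simple_function M (X i)) \<and>
     (\<forall>A. h $ A = prob_space.entropy M b
        (count_space ((\<lambda>\<omega>. \<lambda>i\<in>A. X i \<omega>) ` space M)) (\<lambda>\<omega>. \<lambda>i\<in>A. X i \<omega>)))"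

text \<open>
  The following facts make the abstract notions explicit: the rank-one matroids are exactly the
  uniform matroids of rank one on the nonempty \<open>\<alpha>\<close>, each of them generates an extreme ray, and the
  face spanned by two of these rays consists of the nonnegative combinations of the generators.
\<close>

lemma uniform_rank_1:
  "uniform_rank 1 \<alpha> $ A = (if A \<inter> \<alpha> = {} then 0 else 1)"
  "uniform_rank (Suc 0) \<alpha> $ A = (if A \<inter> \<alpha> = {} then 0 else 1)"
  by (auto simp: uniform_rank_def min_def card_eq_0_iff Suc_le_eq not_le)

lemma uniform_rank_1_in_Gamma4: "uniform_rank 1 \<alpha> \<in> Gamma4"
  unfolding Gamma4_def by (auto simp: uniform_rank_1)

lemma rank_one_matroid_iff: "rank_one_matroid r \<longleftrightarrow> (\<exists>\<alpha>. \<alpha> \<noteq> {} \<and> r = uniform_rank 1 \<alpha>)"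
proof
  assume "rank_one_matroid r"
  then have z: "r $ {} = 0" and nn: "\<And>A. 0 \<le> r $ A" and mono: "\<And>A B. A \<subseteq> B \<Longrightarrow> r $ A \<le> r $ B"
    and sub: "\<And>A B. r $ (A \<union> B) + r $ (A \<inter> B) \<le> r $ A + r $ B"
    and int: "\<And>A. r $ A \<in> \<int>" and one: "r $ UNIV = 1"
    by (auto simp: rank_one_matroid_def matroid_rank_def Gamma4_def)
  have v: "r $ A = 0 \<or> r $ A = 1" for A
  proof -
    obtain k where k: "r $ A = of_int k" using int[of A] by (auto elim: Ints_cases)
    have "0 \<le> k" "k \<le> 1" using nn[of A] mono[of A UNIV] one k by auto
    then show ?thesis using k by (cases "k = 0") auto
  qed
  define \<alpha> where "\<alpha> = {i. r $ {i} = 1}"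
  have zero: "r $ A = 0" if "A \<inter> \<alpha> = {}" for A
    using finite[of A] that
  proof (induction A rule: finite_induct)
    case empty
    then show ?case using z by simp
  next
    case (insert x A)
    then have "r $ {x} = 0" using v[of "{x}"] by (auto simp: \<alpha>_def)
    moreover have "r $ A = 0" using insert by auto
    ultimately have "r $ (insert x A) \<le> 0" using sub[of "{x}" A] nn[of "{x} \<inter> A"] by simp
    then show ?case using nn[of "insert x A"] by simp
  qed
  have nz: "r $ A = 1" if "A \<inter> \<alpha> \<noteq> {}" for A
  proof -
    obtain i where "i \<in> A" "r $ {i} = 1" using \<open>A \<inter> \<alpha> \<noteq> {}\<close> by (auto simp: \<alpha>_def)
    then show ?thesis using mono[of "{i}" A] v[of A] by auto
  qed
  have "r = uniform_rank 1 \<alpha>" using zero nz by (auto simp: vec_eq_iff uniform_rank_1)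
  moreover have "\<alpha> \<noteq> {}" using zero[of UNIV] one by auto
  ultimately show "\<exists>\<alpha>. \<alpha> \<noteq> {} \<and> r = uniform_rank 1 \<alpha>" by blast
next
  assume "\<exists>\<alpha>. \<alpha> \<noteq> {} \<and> r = uniform_rank 1 \<alpha>"
  then obtain \<alpha> where a: "\<alpha> \<noteq> {}" "r = uniform_rank 1 \<alpha>" by blast
  have "r $ A \<le> real (card A)" for A
  proof (cases "A = {}")
    case False
    then have "1 \<le> card A" by (simp add: Suc_le_eq card_gt_0_iff)
    then show ?thesis using a by (simp add: uniform_rank_1)
  qed (use a in \<open>simp add: uniform_rank_1\<close>)
  then show "rank_one_matroid r"
    using a uniform_rank_1_in_Gamma4
    by (auto simp: rank_one_matroid_def matroid_rank_def uniform_rank_1)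
qed

definition span2 :: "set_fun \<Rightarrow> set_fun \<Rightarrow> set_fun set" where
  "span2 r s = {a *\<^sub>R r + b *\<^sub>R s | a b. 0 \<le> a \<and> 0 \<le> b}"

lemma span2_commute: "span2 r s = span2 s r"
  unfolding span2_def by (metis (no_types, opaque_lifting) add.commute)

lemma Gamma4_comb:
  assumes "x \<in> Gamma4" "y \<in> Gamma4" "0 \<le> a" "0 \<le> b"
  shows "a *\<^sub>R x + b *\<^sub>R y \<in> Gamma4"
proof -
  have "a * x $ A + b * y $ A \<le> a * x $ B + b * y $ B" if "A \<subseteq> B" for A B
    using assms that by (intro add_mono mult_left_mono) (auto simp: Gamma4_def)
  moreover have "a * x $ (A \<union> B) + b * y $ (A \<union> B) + (a * x $ (A \<inter> B) + b * y $ (A \<inter> B))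
      \<le> a * x $ A + b * y $ A + (a * x $ B + b * y $ B)" for A B
  proof -
    have "a * (x $ (A \<union> B) + x $ (A \<inter> B)) \<le> a * (x $ A + x $ B)"
      using assms by (intro mult_left_mono) (auto simp: Gamma4_def)
    moreover have "b * (y $ (A \<union> B) + y $ (A \<inter> B)) \<le> b * (y $ A + y $ B)"
      using assms by (intro mult_left_mono) (auto simp: Gamma4_def)
    ultimately show ?thesis by (simp add: algebra_simps)
  qed
  ultimately show ?thesis using assms by (auto simp: Gamma4_def)
qed

lemma face_aux:
  assumes x: "x \<in> Gamma4" and y: "y \<in> Gamma4" and u: "0 < u" "u < 1"
    and z: "(1 - u) *\<^sub>R x + u *\<^sub>R y = a *\<^sub>R uniform_rank 1 \<alpha> + b *\<^sub>R uniform_rank 1 \<beta>"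
    and cas: "\<alpha> \<subseteq> \<beta> \<or> (\<not> \<alpha> \<subseteq> \<beta> \<and> \<not> \<beta> \<subseteq> \<alpha>)"
  shows "x \<in> span2 (uniform_rank 1 \<alpha>) (uniform_rank 1 \<beta>)"
proof -
  have zA: "(1 - u) * x $ A + u * y $ A
      = a * (if A \<inter> \<alpha> = {} then 0 else 1) + b * (if A \<inter> \<beta> = {} then 0 else 1)" for A
    using arg_cong[OF z, of "\<lambda>v. v $ A"] by (simp only: uniform_rank_1 vector_add_component vector_scaleR_component real_scaleR_def)
  have tight: "x $ A = x $ B" if "A \<subseteq> B" "A \<inter> \<alpha> = {} \<longleftrightarrow> B \<inter> \<alpha> = {}" "A \<inter> \<beta> = {} \<longleftrightarrow> B \<inter> \<beta> = {}" for A B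
  proof -
    have le: "x $ A \<le> x $ B" "y $ A \<le> y $ B" using x y that by (auto simp: Gamma4_def)
    have e: "(1 - u) * x $ A + u * y $ A = (1 - u) * x $ B + u * y $ B"
      using zA[of A] zA[of B] that by simp
    have "u * y $ A \<le> u * y $ B" using le u by simp
    then have "(1 - u) * x $ B \<le> (1 - u) * x $ A" using e by linarith
    then show ?thesis using le u by simp
  qed
  have cls: "x $ A = x $ B" if "A \<inter> \<alpha> = {} \<longleftrightarrow> B \<inter> \<alpha> = {}" "A \<inter> \<beta> = {} \<longleftrightarrow> B \<inter> \<beta> = {}" for A B
  proof -
    have "x $ A = x $ (A \<union> B)" by (rule tight) (use that in blast)+
    moreover have "x $ B = x $ (A \<union> B)" by (rule tight) (use that in blast)+
    ultimately show ?thesis by simp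
  qed
  have x0: "x $ {} = 0" and xn: "\<And>A. 0 \<le> x $ A" and xm: "\<And>A B. A \<subseteq> B \<Longrightarrow> x $ A \<le> x $ B"
    using x by (auto simp: Gamma4_def)
  from cas show ?thesis
  proof
    assume s: "\<alpha> \<subseteq> \<beta>"
    have "x $ A = (x $ \<beta> - x $ (\<beta> - \<alpha>)) * (if A \<inter> \<alpha> = {} then 0 else 1)
        + x $ (\<beta> - \<alpha>) * (if A \<inter> \<beta> = {} then 0 else 1)" for A
    proof (cases "A \<inter> \<beta> = {}")
      case True
      then have "A \<inter> \<alpha> = {}" using s by blast
      then show ?thesis using cls[of A "{}"] True x0 by simp
    next
      case False
      show ?thesis
      proof (cases "A \<inter> \<alpha> = {}")
        case True
        have "x $ A = x $ (\<beta> - \<alpha>)" by (rule cls) (use True False in blast)+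
        then show ?thesis using True False by simp
      next
        case f: False
        have "x $ A = x $ \<beta>" by (rule cls) (use f False s in blast)+
        then show ?thesis using f False by simp
      qed
    qed
    then have "x = (x $ \<beta> - x $ (\<beta> - \<alpha>)) *\<^sub>R uniform_rank 1 \<alpha> + x $ (\<beta> - \<alpha>) *\<^sub>R uniform_rank 1 \<beta>"
      unfolding vec_eq_iff vector_add_component vector_scaleR_component uniform_rank_1 real_scaleR_def by blast
    moreover have "0 \<le> x $ \<beta> - x $ (\<beta> - \<alpha>)" using xm[of "\<beta> - \<alpha>" \<beta>] by auto
    ultimately show ?thesis using xn[of "\<beta> - \<alpha>"] unfolding span2_def by blast
  next
    assume n: "\<not> \<alpha> \<subseteq> \<beta> \<and> \<not> \<beta> \<subseteq> \<alpha>"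
    let ?P = "\<alpha> - \<beta>" let ?Q = "\<beta> - \<alpha>"
    have i: "?P \<inter> ?Q = {}" by blast
    have c: "?P \<inter> \<alpha> \<noteq> {}" "?P \<inter> \<beta> = {}" "?Q \<inter> \<beta> \<noteq> {}" "?Q \<inter> \<alpha> = {}"
      "(?P \<union> ?Q) \<inter> \<alpha> \<noteq> {}" "(?P \<union> ?Q) \<inter> \<beta> \<noteq> {}" using n by auto
    have le: "x $ (?P \<union> ?Q) \<le> x $ ?P + x $ ?Q" "y $ (?P \<union> ?Q) \<le> y $ ?P + y $ ?Q"
      using x y i unfolding Gamma4_def by (smt (verit, best) mem_Collect_eq)+
    have e: "(1 - u) * x $ (?P \<union> ?Q) + u * y $ (?P \<union> ?Q)
       = (1 - u) * (x $ ?P + x $ ?Q) + u * (y $ ?P + y $ ?Q)"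
      using zA[of ?P] zA[of ?Q] zA[of "?P \<union> ?Q"] c by (simp add: distrib_left)
    have "u * y $ (?P \<union> ?Q) \<le> u * (y $ ?P + y $ ?Q)" using le u by simp
    then have "(1 - u) * (x $ ?P + x $ ?Q) \<le> (1 - u) * x $ (?P \<union> ?Q)" using e by linarith
    then have md: "x $ (?P \<union> ?Q) = x $ ?P + x $ ?Q" using le u by simp
    have "x $ A = x $ ?P * (if A \<inter> \<alpha> = {} then 0 else 1) + x $ ?Q * (if A \<inter> \<beta> = {} then 0 else 1)" for A
    proof (cases "A \<inter> \<alpha> = {}"; cases "A \<inter> \<beta> = {}")
      assume "A \<inter> \<alpha> = {}" "A \<inter> \<beta> = {}"
      then show ?thesis using cls[of A "{}"] x0 by simp
    next
      assume "A \<inter> \<alpha> = {}" "A \<inter> \<beta> \<noteq> {}"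
      then show ?thesis using cls[of A ?Q] c by simp
    next
      assume "A \<inter> \<alpha> \<noteq> {}" "A \<inter> \<beta> = {}"
      then show ?thesis using cls[of A ?P] c by simp
    next
      assume "A \<inter> \<alpha> \<noteq> {}" "A \<inter> \<beta> \<noteq> {}"
      then show ?thesis using cls[of A "?P \<union> ?Q"] c md by simp
    qed
    then have "x = x $ ?P *\<^sub>R uniform_rank 1 \<alpha> + x $ ?Q *\<^sub>R uniform_rank 1 \<beta>"
      unfolding vec_eq_iff vector_add_component vector_scaleR_component uniform_rank_1 real_scaleR_def by blast
    then show ?thesis using xn unfolding span2_def by blast
  qed
qed

lemma span2_face_of: "span2 (uniform_rank 1 \<alpha>) (uniform_rank 1 \<beta>) face_of Gamma4"
  (is "?F face_of _")
proof -
  have half: "x \<in> ?F" if xy: "x \<in> Gamma4" "y \<in> Gamma4" and z: "z \<in> ?F" "z \<in> open_segment x y" for x y z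
  proof -
    obtain u where u: "0 < u" "u < 1" "z = (1 - u) *\<^sub>R x + u *\<^sub>R y" using z(2) by (auto simp: in_segment)
    obtain a b where ab: "z = a *\<^sub>R uniform_rank 1 \<alpha> + b *\<^sub>R uniform_rank 1 \<beta>"
      using z(1) by (auto simp: span2_def)
    show ?thesis
    proof (cases "\<alpha> \<subseteq> \<beta> \<or> (\<not> \<alpha> \<subseteq> \<beta> \<and> \<not> \<beta> \<subseteq> \<alpha>)")
      case True
      show ?thesis using face_aux[OF xy u(1,2) _ True] u ab by metis
    next
      case False
      then have c: "\<beta> \<subseteq> \<alpha> \<or> (\<not> \<beta> \<subseteq> \<alpha> \<and> \<not> \<alpha> \<subseteq> \<beta>)" by blast
      have "x \<in> span2 (uniform_rank 1 \<beta>) (uniform_rank 1 \<alpha>)"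
        using face_aux[OF xy u(1,2) _ c] u ab by (metis add.commute)
      then show ?thesis by (simp add: span2_commute)
    qed
  qed
  have "?F \<subseteq> Gamma4"
    unfolding span2_def using Gamma4_comb uniform_rank_1_in_Gamma4 by blast
  moreover have "convex ?F"
  proof (rule convexI)
    fix p q :: set_fun and s t :: real
    assume "p \<in> ?F" "q \<in> ?F" and st: "0 \<le> s" "0 \<le> t"
    then obtain a b c d where "p = a *\<^sub>R uniform_rank 1 \<alpha> + b *\<^sub>R uniform_rank 1 \<beta>" "0 \<le> a" "0 \<le> b"
      "q = c *\<^sub>R uniform_rank 1 \<alpha> + d *\<^sub>R uniform_rank 1 \<beta>" "0 \<le> c" "0 \<le> d"
      unfolding span2_def by blast
    then have "s *\<^sub>R p + t *\<^sub>R q = (s * a + t * c) *\<^sub>R uniform_rank 1 \<alpha> + (s * b + t * d) *\<^sub>R uniform_rank 1 \<beta>"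
      "0 \<le> s * a + t * c" "0 \<le> s * b + t * d" using st by (simp_all add: algebra_simps)
    then show "s *\<^sub>R p + t *\<^sub>R q \<in> ?F" unfolding span2_def by blast
  qed
  ultimately show ?thesis
    unfolding face_of_def using half by (metis open_segment_commute)
qed

lemma extreme_ray_uniform_rank_1:
  assumes "\<alpha> \<noteq> {}"
  shows "extreme_ray_of (ray (uniform_rank 1 \<alpha>)) Gamma4"
proof -
  have "span2 (uniform_rank 1 \<alpha>) (uniform_rank 1 \<alpha>) = ray (uniform_rank 1 \<alpha>)"
  proof
    show "span2 (uniform_rank 1 \<alpha>) (uniform_rank 1 \<alpha>) \<subseteq> ray (uniform_rank 1 \<alpha>)"
      unfolding span2_def ray_def
      by clarify (metis add_nonneg_nonneg scaleR_add_left)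
    show "ray (uniform_rank 1 \<alpha>) \<subseteq> span2 (uniform_rank 1 \<alpha>) (uniform_rank 1 \<alpha>)"
    proof
      fix v assume "v \<in> ray (uniform_rank 1 \<alpha>)"
      then obtain a where "v = a *\<^sub>R uniform_rank 1 \<alpha> + 0 *\<^sub>R uniform_rank 1 \<alpha>" "0 \<le> a"
        by (auto simp: ray_def)
      then show "v \<in> span2 (uniform_rank 1 \<alpha>) (uniform_rank 1 \<alpha>)" unfolding span2_def by blast
    qed
  qed
  then have "ray (uniform_rank 1 \<alpha>) face_of Gamma4" using span2_face_of by metis
  moreover have "uniform_rank 1 \<alpha> $ \<alpha> = 1" using assms uniform_rank_1[of \<alpha> \<alpha>] by simp
  then have "uniform_rank 1 \<alpha> \<noteq> 0" by auto
  ultimately show ?thesis unfolding extreme_ray_of_def by blast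
qed

lemma extreme_ray_eq_ray:
  assumes "extreme_ray_of E K" "r \<in> E" "r \<noteq> 0"
  shows "E = ray r"
proof -
  obtain s where s: "E = ray s" using assms by (auto simp: extreme_ray_of_def)
  then obtain c where c: "r = c *\<^sub>R s" "0 < c" using assms by (auto simp: ray_def less_le)
  have "a *\<^sub>R s = (a / c) *\<^sub>R r \<and> 0 \<le> a / c" "a *\<^sub>R r = (a * c) *\<^sub>R s \<and> 0 \<le> a * c" if "0 \<le> a" for a
    using c that by simp_all
  then show ?thesis unfolding s ray_def by blast
qed

lemma spanned_face_eq:
  assumes "rank_one_matroid r1" "rank_one_matroid r2"
  shows "spanned_face Gamma4 (ray r1 \<union> ray r2) = {a *\<^sub>R r1 + b *\<^sub>R r2 | a b. 0 \<le> a \<and> 0 \<le> b}"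
proof -
  have f: "span2 r1 r2 face_of Gamma4" using assms span2_face_of by (auto simp: rank_one_matroid_iff)
  have "v \<in> span2 r1 r2" if "v \<in> ray r1 \<union> ray r2" for v
  proof -
    have "v = a *\<^sub>R r1 \<Longrightarrow> v = a *\<^sub>R r1 + 0 *\<^sub>R r2" "v = a *\<^sub>R r2 \<Longrightarrow> v = 0 *\<^sub>R r1 + a *\<^sub>R r2" for a
      by simp_all
    with that have "\<exists>a b. v = a *\<^sub>R r1 + b *\<^sub>R r2 \<and> 0 \<le> a \<and> 0 \<le> b"
      unfolding ray_def by blast
    then show ?thesis unfolding span2_def by blast
  qed
  then have "spanned_face Gamma4 (ray r1 \<union> ray r2) \<subseteq> span2 r1 r2"
    unfolding spanned_face_def using f by (intro hull_minimal) auto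
  moreover have "a *\<^sub>R r1 + b *\<^sub>R r2 \<in> T"
    if T: "T face_of Gamma4" "ray r1 \<union> ray r2 \<subseteq> T" and ab: "0 \<le> a" "0 \<le> b" for a b T
  proof -
    have "(2 * a) *\<^sub>R r1 \<in> ray r1" unfolding ray_def using ab by (intro CollectI exI[of _ "2 * a"]) auto
    moreover have "(2 * b) *\<^sub>R r2 \<in> ray r2" unfolding ray_def using ab by (intro CollectI exI[of _ "2 * b"]) auto
    ultimately have "(2 * a) *\<^sub>R r1 \<in> T" "(2 * b) *\<^sub>R r2 \<in> T" using T(2) by auto
    then have "(1/2) *\<^sub>R ((2 * a) *\<^sub>R r1) + (1/2) *\<^sub>R ((2 * b) *\<^sub>R r2) \<in> T"
      using T(1) by (intro convexD) (auto simp: face_of_def)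
    then show ?thesis by simp
  qed
  then have "span2 r1 r2 \<subseteq> spanned_face Gamma4 (ray r1 \<union> ray r2)"
    unfolding spanned_face_def hull_def span2_def by blast
  ultimately show ?thesis by (auto simp: span2_def)
qed

end

theory Submission
  imports Defs "HOL-Real_Asymp.Real_Asymp"
begin

text \<open>
  A rank-one matroid is the indicator of \<open>A \<inter> \<alpha> \<noteq> {}\<close>, so a point of the face has the form
  \<open>A \<mapsto> c [A \<inter> \<alpha> \<noteq> {}] + d [A \<inter> \<beta> \<noteq> {}]\<close>.  Take independent \<open>Y\<close> and \<open>Z\<close> with entropies \<open>c\<close>
  and \<open>d\<close>, and let \<open>X i\<close> consist of \<open>Y\<close> if \<open>i \<in> \<alpha>\<close> and of \<open>Z\<close> if \<open>i \<in> \<beta>\<close>.  Every entropy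
  \<open>c \<ge> 0\<close> occurs: \<open>k\<close> independent copies of a coin with entropy \<open>c / k \<le> log b 2\<close>, which exists by
  the intermediate value theorem.
\<close>

text \<open>Summing over the support keeps every probability positive, as \<open>log_mult\<close>
  requires.\<close>

definition pmf_entropy :: "real \<Rightarrow> 'a pmf \<Rightarrow> real" where
  "pmf_entropy b p = - (\<Sum>x\<in>set_pmf p. pmf p x * log b (pmf p x))"

lemma pmf_entropy_superset:
  assumes "finite S" "set_pmf p \<subseteq> S"
  shows "pmf_entropy b p = - (\<Sum>x\<in>S. pmf p x * log b (pmf p x))"
  unfolding pmf_entropy_def
  by (intro arg_cong[of _ _ uminus] sum.mono_neutral_left) (use assms in \<open>auto simp: set_pmf_iff\<close>)

lemma pmf_entropy_return [simp]: "pmf_entropy b (return_pmf x) = 0"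
  by (simp add: pmf_entropy_def)

lemma pmf_entropy_map_inj:
  assumes "inj_on f (set_pmf p)"
  shows "pmf_entropy b (map_pmf f p) = pmf_entropy b p"
  unfolding pmf_entropy_def by (simp add: sum.reindex[OF assms] pmf_map_inj[OF assms])

text \<open>The logarithm splits each product of probabilities into two terms, and the marginal left
  over in each term sums to 1.\<close>

lemma pmf_entropy_pair:
  assumes fin: "finite (set_pmf p)" "finite (set_pmf q)"
  shows "pmf_entropy b (pair_pmf p q) = pmf_entropy b p + pmf_entropy b q"
proof -
  have 1: "(\<Sum>x\<in>set_pmf p. pmf p x) = 1" "(\<Sum>y\<in>set_pmf q. pmf q y) = 1"
    using fin by (auto intro: sum_pmf_eq_1)
  have "(\<Sum>z\<in>set_pmf p \<times> set_pmf q. pmf (pair_pmf p q) z * log b (pmf (pair_pmf p q) z))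
      = (\<Sum>x\<in>set_pmf p. \<Sum>y\<in>set_pmf q. pmf q y * (pmf p x * log b (pmf p x))
          + pmf p x * (pmf q y * log b (pmf q y)))"
    unfolding sum.cartesian_product
    by (intro sum.cong) (auto simp: pmf_pair log_mult pmf_positive algebra_simps)
  also have "\<dots> = (\<Sum>x\<in>set_pmf p. pmf p x * log b (pmf p x)) + (\<Sum>y\<in>set_pmf q. pmf q y * log b (pmf q y))"
    by (simp add: sum.distrib 1 flip: sum_distrib_left sum_distrib_right)
  finally show ?thesis by (simp add: pmf_entropy_def)
qed

text \<open>Bridge from the measure-theoretic entropy in \<open>entropic\<close> to a finite sum;
  values of \<open>X\<close> outside the support add zero terms.\<close>

lemma entropy_measure_pmf:
  assumes "1 < b" "simple_function (measure_pmf P) X"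
  shows "prob_space.entropy (measure_pmf P) b (count_space (X ` space (measure_pmf P))) X
    = pmf_entropy b (map_pmf X P)"
proof -
  have info: "information_space (measure_pmf P) b"
    by unfold_locales (rule assms)
  have "simple_distributed (measure_pmf P) X (pmf (map_pmf X P))"
    using assms(2) by (intro prob_space.simple_distributedI[OF prob_space_measure_pmf]) (auto simp: pmf_map vimage_def)
  then have "prob_space.entropy (measure_pmf P) b (count_space (X ` space (measure_pmf P))) X
      = - (\<Sum>x\<in>range X. pmf (map_pmf X P) x * log b (pmf (map_pmf X P) x))"
    using information_space.entropy_simple_distributed[OF info] by simp
  also have "\<dots> = pmf_entropy b (map_pmf X P)"
    using assms(2) by (intro pmf_entropy_superset[symmetric]) (auto simp: simple_function_def)
  finally show ?thesis .
qed

lemma continuous_on_x_log_x: "continuous_on {0..} (\<lambda>x. x * log b x)"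
proof -
  have "((\<lambda>x::real. x * ln x) \<longlongrightarrow> 0) (at_right 0)" by real_asymp
  \<comment> \<open>Only 0 is critical: the factor 0 makes the value there 0, which is the one-sided
    limit.\<close>
  then have "((\<lambda>x::real. x * ln x) \<longlongrightarrow> 0 * ln 0) (at 0 within {0..})"
    by (simp add: at_within_Ici_at_right)
  then have "continuous (at x within {0..}) (\<lambda>x::real. x * ln x)" if "0 \<le> x" for x :: real
    using that by (cases "x = 0") (auto simp: continuous_within intro!: tendsto_intros)
  then have "continuous_on {0..} (\<lambda>x::real. x * ln x * (1 / ln b))"
    by (intro continuous_on_mult_right) (simp add: continuous_on_eq_continuous_within)
  then show ?thesis by (simp add: log_def)
qed

lemma ex_bernoulli_entropy:
  assumes "1 < b" "0 \<le> x" "x \<le> log b 2"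
  shows "\<exists>t. pmf_entropy b (bernoulli_pmf t) = x"
proof -
  define H where "H t = - (t * log b t + (1 - t) * log b (1 - t))" for t :: real
  have eq: "pmf_entropy b (bernoulli_pmf t) = H t" if "0 \<le> t" "t \<le> 1" for t
    by (subst pmf_entropy_superset[of UNIV]) (use that in \<open>auto simp: H_def UNIV_bool\<close>)
  \<comment> \<open>On this interval the binary entropy goes from 0 (constant coin) to
    \<open>log b 2\<close> (fair coin).\<close>
  have "continuous_on {0..1/2} H"
    unfolding H_def
    by (intro continuous_intros continuous_on_compose2[OF continuous_on_x_log_x]) auto
  moreover have "H 0 = 0" "H (1/2) = log b 2"
    using assms(1) by (simp_all add: H_def log_divide)
  ultimately obtain t where "0 \<le> t" "t \<le> 1/2" "H t = x"
    using IVT'[of H 0 x "1/2"] assms by auto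
  then show ?thesis using eq[of t] by auto
qed

text \<open>Each step pairs in one more independent copy; the injective \<open>to_nat\<close>
  preserves entropy and brings the pair back to \<open>nat\<close>.\<close>

lemma ex_pmf_entropy_mult:
  assumes "finite (set_pmf (p :: 'a :: countable pmf))"
  shows "\<exists>q :: nat pmf. finite (set_pmf q) \<and> pmf_entropy b q = real k * pmf_entropy b p"
proof (induction k)
  case 0
  show ?case by (intro exI[of _ "return_pmf 0"]) simp
next
  case (Suc k)
  then obtain q :: "nat pmf" where q: "finite (set_pmf q)" "pmf_entropy b q = real k * pmf_entropy b p"
    by blast
  let ?r = "map_pmf to_nat (pair_pmf p q)"
  have "pmf_entropy b ?r = real (Suc k) * pmf_entropy b p"
    using assms q by (simp add: pmf_entropy_map_inj pmf_entropy_pair algebra_simps)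
  then show ?case using assms q by (intro exI[of _ ?r]) simp
qed

lemma ex_pmf_entropy:
  assumes "1 < b" "0 \<le> x"
  shows "\<exists>q :: nat pmf. finite (set_pmf q) \<and> pmf_entropy b q = x"
proof -
  have pos: "0 < log b 2" using assms(1) by simp
  \<comment> \<open>The strict bound gives \<open>k > 0\<close> even for \<open>x = 0\<close>, so
    division by \<open>k\<close> is sound.\<close>
  obtain k where k: "x / log b 2 < real k" using reals_Archimedean2 by blast
  moreover have "0 \<le> x / log b 2" using assms pos by simp
  ultimately have k0: "0 < real k" by linarith
  have "x / real k \<le> log b 2" using k k0 pos by (simp add: field_simps)
  then obtain t where "pmf_entropy b (bernoulli_pmf t) = x / real k"
    using ex_bernoulli_entropy[of b "x / real k"] assms by auto
  then show ?thesis
    using ex_pmf_entropy_mult[of "bernoulli_pmf t" b k] k0 by simp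
qed

text \<open>Up to an injective recoding, the subvector on \<open>A\<close> is the part of the pair
  that \<open>A\<close> sees: the first component if \<open>A\<close> meets \<open>\<alpha>\<close>,
  the second if \<open>A\<close> meets \<open>\<beta>\<close>.\<close>

lemma entropic_uniform_rank_1_comb:
  fixes \<alpha> \<beta> :: "4 set"
  assumes b: "1 < b" and "0 \<le> c" "0 \<le> d"
  shows "entropic b (c *\<^sub>R uniform_rank 1 \<alpha> + d *\<^sub>R uniform_rank 1 \<beta>)"
proof -
  obtain p q :: "nat pmf" where p: "finite (set_pmf p)" "pmf_entropy b p = c"
    and q: "finite (set_pmf q)" "pmf_entropy b q = d"
    using ex_pmf_entropy[OF b] assms by metis
  obtain n where n: "set_pmf p \<subseteq> {..n}" "set_pmf q \<subseteq> {..n}"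
    using p(1) q(1) by (metis finite_Un finite_nat_iff_bounded_le le_sup_iff)
  define P where "P = map_pmf prod_encode (pair_pmf p q)"
  \<comment> \<open>\<open>simple_function\<close> needs a finite range on all of \<open>nat\<close>, not just on the support of \<open>P\<close>, hence
    the truncation at \<open>n\<close>.\<close>
  define proj where "proj S T = map_prod (\<lambda>y. if S then min y n else 0) (\<lambda>z. if T then min z n else 0)"
    for S T
  define X where "X i \<omega> = prod_encode (proj (i \<in> \<alpha>) (i \<in> \<beta>) (prod_decode \<omega>))" for i :: 4 and \<omega>
  have rng: "proj S T w \<in> {..n} \<times> {..n}" for S T w
    by (cases w) (auto simp: proj_def)
  have "range (X i) \<subseteq> prod_encode ` ({..n} \<times> {..n})" for i
    unfolding X_def using rng by blast
  then have fX: "finite (range (X i))" for i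
    by (rule finite_subset) auto
  have entropy_eq: "prob_space.entropy (measure_pmf P) b
        (count_space ((\<lambda>\<omega>. \<lambda>i\<in>A. X i \<omega>) ` space (measure_pmf P))) (\<lambda>\<omega>. \<lambda>i\<in>A. X i \<omega>)
      = c * (if A \<inter> \<alpha> = {} then 0 else 1) + d * (if A \<inter> \<beta> = {} then 0 else 1)" for A
  proof -
    let ?XA = "\<lambda>\<omega>. \<lambda>i\<in>A. X i \<omega>"
    let ?S = "A \<inter> \<alpha> \<noteq> {}" and ?T = "A \<inter> \<beta> \<noteq> {}"
    define g where "g w = (\<lambda>i\<in>A. prod_encode (proj (i \<in> \<alpha>) (i \<in> \<beta>) w))" for w
    \<comment> \<open>\<open>p'\<close> and \<open>q'\<close> are the laws of the components seen by
      \<open>A\<close>; an unseen one becomes the constant 0, of entropy 0.\<close>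
    define p' where "p' = (if ?S then p else return_pmf 0)"
    define q' where "q' = (if ?T then q else return_pmf 0)"
    have "range ?XA \<subseteq> (\<Pi>\<^sub>E i\<in>A. range (X i))" by auto
    then have "finite (range ?XA)"
      by (rule finite_subset) (use fX in \<open>intro finite_PiE, auto\<close>)
    then have sf: "simple_function (measure_pmf P) ?XA"
      by (simp add: simple_function_def)
    have "map_pmf (\<lambda>y. if ?S then min y n else 0) p = p'"
      "map_pmf (\<lambda>z. if ?T then min z n else 0) q = q'"
      using n by (auto simp: p'_def q'_def map_pmf_const intro!: map_pmf_idI min_absorb1)
    then have "map_pmf (proj ?S ?T) (pair_pmf p q) = pair_pmf p' q'"
      unfolding proj_def by (simp add: map_prod_def map_pair)
    \<comment> \<open>Masking first by what all of \<open>A\<close> sees loses nothing: whatever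
      some \<open>i\<close> in \<open>A\<close> sees, \<open>A\<close> sees, and truncation is
      idempotent.\<close>
    moreover have "?XA (prod_encode w) = g (proj ?S ?T w)" for w
      by (cases w) (auto simp: X_def g_def proj_def fun_eq_iff)
    then have "map_pmf ?XA P = map_pmf g (map_pmf (proj ?S ?T) (pair_pmf p q))"
      unfolding P_def map_pmf_comp by (rule map_pmf_cong[OF refl])
    ultimately have law: "map_pmf ?XA P = map_pmf g (pair_pmf p' q')"
      by simp
    \<comment> \<open>A seen component is read off at some \<open>i\<close> in \<open>A\<close>,
      where truncation at \<open>n\<close> does not alter it; an unseen one is always 0.\<close>
    have "inj_on g (set_pmf (pair_pmf p' q'))"
    proof (rule inj_onI; clarsimp)
      fix y z y' z'
      assume m: "y \<in> set_pmf p'" "z \<in> set_pmf q'" "y' \<in> set_pmf p'" "z' \<in> set_pmf q'"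
        and eq: "g (y, z) = g (y', z')"
      have eq': "proj (i \<in> \<alpha>) (i \<in> \<beta>) (y, z) = proj (i \<in> \<alpha>) (i \<in> \<beta>) (y', z')" if "i \<in> A" for i
        using fun_cong[OF eq, of i] that by (simp add: g_def)
      have "y = y'"
      proof (cases ?S)
        case True
        then obtain i where "i \<in> A" "i \<in> \<alpha>" by blast
        moreover have "y \<le> n" "y' \<le> n" using m n True by (auto simp: p'_def)
        ultimately show ?thesis using eq'[of i] by (simp add: proj_def)
      qed (use m in \<open>simp add: p'_def\<close>)
      moreover have "z = z'"
      proof (cases ?T)
        case True
        then obtain i where "i \<in> A" "i \<in> \<beta>" by blast
        moreover have "z \<le> n" "z' \<le> n" using m n True by (auto simp: q'_def)
        ultimately show ?thesis using eq'[of i] by (simp add: proj_def)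
      qed (use m in \<open>simp add: q'_def\<close>)
      ultimately show "y = y' \<and> z = z'" by blast
    qed
    then have "pmf_entropy b (map_pmf ?XA P) = pmf_entropy b p' + pmf_entropy b q'"
      unfolding law
      by (subst pmf_entropy_map_inj) (use p q in \<open>auto simp: pmf_entropy_pair p'_def q'_def\<close>)
    then show ?thesis
      using entropy_measure_pmf[OF b sf] p q by (simp add: p'_def q'_def)
  qed
  have "simple_function (measure_pmf P) (X i)" for i
    using fX by (simp add: simple_function_def)
  then show ?thesis
    unfolding entropic_def vector_add_component vector_scaleR_component uniform_rank_1 real_scaleR_def
    by (intro exI[of _ "measure_pmf P"] exI[of _ X] conjI allI)
      (simp_all only: entropy_eq prob_space_measure_pmf)
qed

theorem mainTheorem3:
  fixes E1 E2 F :: "set_fun set" and r1 r2 h :: set_fun and b :: real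
  assumes "1 < b"
    and "extreme_ray_of E1 Gamma4" and "extreme_ray_of E2 Gamma4" and "E1 \<noteq> E2"
    and "r1 \<in> E1" and "rank_one_matroid r1"
    and "r2 \<in> E2" and "rank_one_matroid r2"
    and "F = spanned_face Gamma4 (E1 \<union> E2)"
    and "h \<in> F"
  shows "entropic b h"
proof -
  \<comment> \<open>Rank 1 on the full set excludes 0, so each matroid generates its ray.\<close>
  have "r1 \<noteq> 0" "r2 \<noteq> 0"
    using assms by (auto simp: rank_one_matroid_def)
  then have "E1 = ray r1" "E2 = ray r2"
    using assms extreme_ray_eq_ray by blast+
  then obtain c d where "0 \<le> c" "0 \<le> d" "h = c *\<^sub>R r1 + d *\<^sub>R r2"
    using assms spanned_face_eq by auto
  moreover obtain \<alpha> \<beta> where "r1 = uniform_rank 1 \<alpha>" "r2 = uniform_rank 1 \<beta>"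
    using assms rank_one_matroid_iff by metis
  ultimately show ?thesis
    using entropic_uniform_rank_1_comb \<open>1 < b\<close> by simp
qed

end
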